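(* Let $\bm A\in\mathbb R^{m\times n}$, $\bm D\in\mathbb R^{n\times d}$ with $\bm D\bm D^\top=\bm I_n$, $0<\alpha\le1$, $\lambda>0$, let $s\ge2$ be an integer, and let $\bm b=\bm A\bm x+\bm e$ with $\bm x\in\mathbb R^n$, $\|\bm e\|_2\le\lambda$. Let $T$ be an index set of $s$ largest-magnitude entries of $\bm D^\top\bm x$, and let $\hat{\bm x}$ be a minimizer of $$\min_{\bm x\in\mathbb R^n}\ \lambda\big(\|\bm D^\top\bm x\|_1-\alpha\|\bm D^\top\bm x\|_2\big)+\tfrac12\|\bm A\bm x-\bm b\|_2^2.$$ Set $K=\sqrt{\frac{\alpha+\sqrt s}{\sqrt s}+\frac{\alpha^2}{4s}}+\frac{\alpha+1}{2\sqrt s}+1$. (i) Let $t\ge3$ be real and suppose $\rho:=\rho_{s,t}=\delta_{ts}+\sqrt{\frac{\lceil(t-1)s\rceil}{(t-1)^2s}}\frac{(\sqrt2+1)(\sqrt s+\alpha)}{\sqrt2(\sqrt s-1)}\theta_{ts,(t-1)s}<1$. Set $\delta:=\delta_{ts}$, $\tau=\frac{(\sqrt2+1)\theta_{ts,(t-1)s}}{\sqrt2(1-\rho)}\frac{\sqrt{(t-1)s}}{(t-1)(s-\sqrt s)}$, $C=1+\frac{(\sqrt2+1)\theta_{ts,(t-1)s}}{\sqrt2(1-\rho)}\frac{\sqrt s+\alpha}{s-\sqrt s}\frac{\sqrt{(t-1)s}}{t-1}$, and $Q=C(1-\rho)+(\sqrt s+\alpha)\sqrt{1+\delta}$. Then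 $$\|\hat{\bm x}-\bm x\|_2\le\Big(K\Big(\tau+\frac{(\tau(1-\rho)+\sqrt{1+\delta})C}{Q}\Big)+\frac12\Big(1+\frac{C(1-\rho)}{Q}\Big)\Big)2\|\bm D_{T^c}^\top\bm x\|_1+\Big(K\frac{\tau(1-\rho)+\sqrt{1+\delta}}{1-\rho}+\frac12\Big)\Big(C+\frac{(\sqrt s+\alpha)\sqrt{1+\delta}}{1-\rho}\Big)2\lambda.$$ (ii) Suppose instead $\rho:=\rho_s=\delta_s+\frac{(\sqrt2+1)(\sqrt s+\alpha)}{\sqrt2(\sqrt s-1)}\theta_{s,s}<1$, and set $\delta:=\delta_s$, $\tau=\frac{(\sqrt2+1)\theta_{s,s}}{\sqrt2(1-\rho)}\frac1{\sqrt s-1}$, $C=1+\frac{(\sqrt2+1)\theta_{s,s}}{\sqrt2(1-\rho)}\frac{\sqrt s+\alpha}{\sqrt s-1}$, $Q=C(1-\rho)+(\sqrt s+\alpha)\sqrt{1+\delta}$. Then the same bound as in (i) holds with these $\rho,\delta,\tau,C,Q$.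
   Context: For an index set $S\subseteq\{1,\dots,d\}$, $S^c$ is its complement and $\bm D_S$ denotes $\bm D$ with all columns not indexed by $S$ set to zero (so $\bm D_{T^c}^\top\bm x$ is $\bm D^\top\bm x$ with entries in $T$ set to zero). A vector is $s$-sparse if it has at most $s$ nonzero entries. $\delta_s$ (the $\bm D$-RIC) is the smallest $\delta\ge0$ with $(1-\delta)\|\bm D\bm v\|_2^2\le\|\bm A\bm D\bm v\|_2^2\le(1+\delta)\|\bm D\bm v\|_2^2$ for all $s$-sparse $\bm v\in\mathbb R^d$; $\theta_{s,t}$ (the $\bm D$-ROC) is the smallest nonnegative number with $|\langle\bm A\bm D\bm u,\bm A\bm D\bm v\rangle-\langle\bm D\bm u,\bm D\bm v\rangle|\le\theta_{s,t}\|\bm u\|_2\|\bm v\|_2$ for all $s$-sparse $\bm u$ and $t$-sparse $\bm v$ in $\mathbb R^d$. For non-integer orders, $\delta_{ts}:=\delta_{\lceil ts\rceil}$ and $\theta_{ts,(t-1)s}:=\theta_{\lceil ts\rceil,\lceil(t-1)s\rceil}$. *)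

theory Defs
  imports "HOL-Analysis.Analysis"
begin

definition l1norm :: "real^'d \<Rightarrow> real" where
  "l1norm v = (\<Sum>i\<in>UNIV. \<bar>v $ i\<bar>)"

definition sparse :: "nat \<Rightarrow> real^'d \<Rightarrow> bool" where
  "sparse s v \<longleftrightarrow> card {i. v $ i \<noteq> 0} \<le> s"

definition D_RIC :: "real^'n^'m \<Rightarrow> real^'d^'n \<Rightarrow> nat \<Rightarrow> real" where
  "D_RIC A D s = Inf {\<delta>. \<delta> \<ge> 0 \<and> (\<forall>v::real^'d. sparse s v \<longrightarrow>
      (1 - \<delta>) * (norm (D *v v))\<^sup>2 \<le> (norm (A *v (D *v v)))\<^sup>2 \<and>
      (norm (A *v (D *v v)))\<^sup>2 \<le> (1 + \<delta>) * (norm (D *v v))\<^sup>2)}"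

definition D_ROC :: "real^'n^'m \<Rightarrow> real^'d^'n \<Rightarrow> nat \<Rightarrow> nat \<Rightarrow> real" where
  "D_ROC A D s t = Inf {\<theta>. \<theta> \<ge> 0 \<and> (\<forall>u v::real^'d. sparse s u \<longrightarrow> sparse t v \<longrightarrow>
      \<bar>(A *v (D *v u)) \<bullet> (A *v (D *v v)) - (D *v u) \<bullet> (D *v v)\<bar> \<le> \<theta> * norm u * norm v)}"

definition objective :: "real^'n^'m \<Rightarrow> real^'d^'n \<Rightarrow> real \<Rightarrow> real \<Rightarrow> real^'m \<Rightarrow> real^'n \<Rightarrow> real" where
  "objective A D \<alpha> lam b z =
     lam * (l1norm (transpose D *v z) - \<alpha> * norm (transpose D *v z))
     + 1/2 * (norm (A *v z - b))\<^sup>2"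

definition recovery_bound :: "nat \<Rightarrow> real \<Rightarrow> real \<Rightarrow> real \<Rightarrow> real \<Rightarrow> real \<Rightarrow> real \<Rightarrow> real \<Rightarrow> real" where
  "recovery_bound s \<alpha> \<rho> \<delta> \<tau> C lam tail =
    (let K = sqrt ((\<alpha> + sqrt s) / sqrt s + \<alpha>\<^sup>2 / (4 * s)) + (\<alpha> + 1) / (2 * sqrt s) + 1;
         Q = C * (1 - \<rho>) + (sqrt s + \<alpha>) * sqrt (1 + \<delta>)
     in (K * (\<tau> + (\<tau> * (1 - \<rho>) + sqrt (1 + \<delta>)) * C / Q) + 1/2 * (1 + C * (1 - \<rho>) / Q)) * 2 * tail
        + (K * (\<tau> * (1 - \<rho>) + sqrt (1 + \<delta>)) / (1 - \<rho>) + 1/2)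
          * (C + (sqrt s + \<alpha>) * sqrt (1 + \<delta>) / (1 - \<rho>)) * 2 * lam)"

end

theory Submission
  imports Defs
begin

text \<open>
  Let \<open>w = D\<^sup>T (xhat - x)\<close>. Minimality of \<open>xhat\<close> gives a cone condition bounding the \<open>\<ell>\<^sub>1\<close>
  norm of \<open>w\<close> off its \<open>s\<close> largest entries \<open>S\<close>. For a suitable \<open>U \<supseteq> S\<close> the rest of \<open>w\<close>
  is flat (bounded sup norm and \<open>\<ell>\<^sub>1\<close> norm), so its interaction with \<open>w\<^sub>U\<close> is controlled by the
  restricted orthogonality constant, and \<open>D D\<^sup>T = I\<close> turns the restricted isometry inequality into a
  bound of \<open>w\<^sub>U\<close> by \<open>\<parallel>A (xhat - x)\<parallel>\<close> and the tail of \<open>D\<^sup>T x\<close>. Inserting it into the cone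
  condition yields a quadratic inequality for \<open>\<parallel>A (xhat - x)\<parallel>\<close>. The factor \<open>(\<surd>2 + 1) / \<surd>2\<close> of the
  statement is only used through being at least \<open>3/2\<close>, which absorbs the AM-GM loss in bounding the
  \<open>\<ell>\<^sub>2\<close> norm of the tail of \<open>w\<close>.
\<close>

section \<open>Restrictions of a vector to an index set and their norms\<close>

definition restr :: "'d set \<Rightarrow> real^'d \<Rightarrow> real^'d" where
  "restr S v = (\<chi> i. if i \<in> S then v $ i else 0)"

lemma restr_add_compl: "restr S v + restr (- S) v = v"
  by (simp add: restr_def vec_eq_iff)

lemma norm_restr_sq: "(norm (restr S v))\<^sup>2 = (\<Sum>i\<in>S. (v $ i)\<^sup>2)"
proof -
  have "(norm (restr S v))\<^sup>2 = (\<Sum>i\<in>UNIV. if i \<in> S then (v $ i)\<^sup>2 else 0)"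
    unfolding norm_vec_def L2_set_def
    by (subst real_sqrt_pow2) (auto intro!: sum_nonneg sum.cong simp: restr_def)
  then show ?thesis by (simp add: sum.If_cases)
qed

lemma inner_restr_self: "restr S v \<bullet> v = (norm (restr S v))\<^sup>2"
proof -
  have "restr S v \<bullet> v = (\<Sum>i\<in>UNIV. if i \<in> S then (v $ i)\<^sup>2 else 0)"
    unfolding inner_vec_def by (auto intro!: sum.cong simp: restr_def power2_eq_square)
  then show ?thesis by (simp add: sum.If_cases norm_restr_sq)
qed

lemma l1norm_restr: "l1norm (restr S v) = (\<Sum>i\<in>S. \<bar>v $ i\<bar>)"
proof -
  have "l1norm (restr S v) = (\<Sum>i\<in>UNIV. if i \<in> S then \<bar>v $ i\<bar> else 0)"
    unfolding l1norm_def by (auto intro!: sum.cong simp: restr_def)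
  then show ?thesis by (simp add: sum.If_cases)
qed

lemma sparse_restr: "card S \<le> k \<Longrightarrow> sparse k (restr S v)"
  unfolding sparse_def restr_def
  by (rule order_trans[OF card_mono]) auto

lemma sum_abs_le_sqrt_card: "(\<Sum>i\<in>S. \<bar>v $ i\<bar>) \<le> sqrt (card S) * norm (restr S v)"
proof -
  have "(\<Sum>i\<in>S. 1 * \<bar>v $ i\<bar>)\<^sup>2 \<le> (\<Sum>i\<in>S. 1\<^sup>2) * (\<Sum>i\<in>S. \<bar>v $ i\<bar>\<^sup>2)"
    by (rule Cauchy_Schwarz_ineq_sum)
  also have "\<dots> = (sqrt (card S) * norm (restr S v))\<^sup>2"
    by (simp add: power_mult_distrib norm_restr_sq)
  finally have "(\<Sum>i\<in>S. \<bar>v $ i\<bar>)\<^sup>2 \<le> (sqrt (card S) * norm (restr S v))\<^sup>2"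
    by (simp only: mult_1)
  then show ?thesis by (rule power2_le_imp_le) simp
qed

text \<open>Interpolation between the sup norm and the l1 norm. It later turns a flat tail with a
  known l1 norm into a tail with a controlled l2 norm.\<close>

lemma norm_sq_le_sup_l1:
  assumes "\<And>i. i \<in> S \<Longrightarrow> \<bar>v $ i\<bar> \<le> \<beta>"
  shows "(norm (restr S v))\<^sup>2 \<le> \<beta> * (\<Sum>i\<in>S. \<bar>v $ i\<bar>)"
proof -
  have "(v $ i)\<^sup>2 \<le> \<beta> * \<bar>v $ i\<bar>" if "i \<in> S" for i
    using mult_right_mono[OF assms[OF that], of "\<bar>v $ i\<bar>"]
    by (simp add: power2_eq_square flip: abs_mult)
  then show ?thesis by (simp add: norm_restr_sq sum_distrib_left sum_mono)
qed

section \<open>Largest entries, and functionals controlled on sparse vectors\<close>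

text \<open>Greedy selection: each step adds a maximiser of the complement. A single threshold
  \<open>\<gamma>\<close> separating inside from outside is returned because the later estimates
  only compare entries with that number.\<close>

lemma ex_largest_entries:
  fixes f :: "'d::finite \<Rightarrow> real"
  assumes "k \<le> CARD('d)" and nonneg: "\<And>i. f i \<ge> 0"
  obtains S \<gamma> where "card S = k" "\<gamma> \<ge> 0" "\<And>i. i \<in> S \<Longrightarrow> \<gamma> \<le> f i" "\<And>i. i \<notin> S \<Longrightarrow> f i \<le> \<gamma>"
proof -
  have "\<exists>S. card S = k \<and> (\<forall>i\<in>S. \<forall>j. j \<notin> S \<longrightarrow> f j \<le> f i)"
    using assms(1)
  proof (induction k)
    case 0
    show ?case by (intro exI[of _ "{}"]) auto
  next
    case (Suc k)
    then obtain S where S: "card S = k" "\<forall>i\<in>S. \<forall>j. j \<notin> S \<longrightarrow> f j \<le> f i" by auto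
    then have ne: "f ` (- S) \<noteq> {}"
      using Suc.prems by (metis Compl_empty_eq Compl_eq_Diff_UNIV Diff_eq_empty_iff
          Suc_n_not_le_n double_complement image_is_empty)
    from Max_in[OF _ ne] obtain m where m: "m \<notin> S" "f m = Max (f ` (- S))" by force
    have "f j \<le> f m" if "j \<notin> S" for j using that m by simp
    with S m show ?case by (intro exI[of _ "insert m S"]) auto
  qed
  then obtain S where S: "card S = k" "\<And>i j. i \<in> S \<Longrightarrow> j \<notin> S \<Longrightarrow> f j \<le> f i" by blast
  show thesis
  proof (cases "S = UNIV")
    case True
    \<comment> \<open>With an empty complement there is no maximum to serve as threshold; 0 works
      since \<open>f\<close> is nonnegative.\<close>
    with S(1) nonneg show thesis by (intro that[of S 0]) auto
  next
    case False
    then have ne: "f ` (- S) \<noteq> {}" by auto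
    from Max_in[OF _ ne] obtain m where m: "m \<notin> S" "f m = Max (f ` (- S))" by force
    have "f j \<le> f m" if "j \<notin> S" for j using that m by simp
    with S m nonneg show thesis by (intro that[of S "f m"]) blast+
  qed
qed

text \<open>Exchange argument: \<open>T - S\<close> and \<open>S - T\<close> have equal size, and
  \<open>\<gamma>\<close> bounds \<open>f\<close> from above on the first and from below on the
  second.\<close>

lemma sum_le_sum_largest:
  fixes f :: "'d::finite \<Rightarrow> real"
  assumes "card T = card S" "\<And>i. i \<in> S \<Longrightarrow> \<gamma> \<le> f i" "\<And>i. i \<notin> S \<Longrightarrow> f i \<le> \<gamma>"
  shows "sum f T \<le> sum f S"
proof -
  have "card (T - S) = card (S - T)"
    using assms(1) by (metis card_le_sym_Diff card_le_sym_Diff finite order_antisym order_refl)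
  have "sum f T = sum f (T \<inter> S) + sum f (T - S)" by (simp add: sum.Int_Diff[of T])
  also have "sum f (T - S) \<le> of_nat (card (T - S)) * \<gamma>"
    by (rule sum_bounded_above) (use assms(3) in auto)
  also have "\<dots> = of_nat (card (S - T)) * \<gamma>" using \<open>card (T - S) = card (S - T)\<close> by simp
  also have "\<dots> \<le> sum f (S - T)"
    by (rule sum_bounded_below) (use assms(2) in auto)
  also have "sum f (T \<inter> S) + sum f (S - T) = sum f S"
    by (metis Int_commute finite sum.Int_Diff)
  finally show ?thesis by simp
qed

text \<open>Replaces the sparse representation of a polytope (writing \<open>v\<close> as a convex combination of
  \<open>k\<close>-sparse vectors): subtracting the threshold \<open>\<gamma>\<close> from the entries of \<open>g\<close> reduces the pairing
  to the \<open>k\<close> largest entries of \<open>g\<close>.\<close>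

lemma sparse_functional_bound:
  fixes g v :: "real^'d"
  assumes sparse_bound: "\<And>u. sparse k u \<Longrightarrow> \<bar>g \<bullet> u\<bar> \<le> G * norm u" and G: "G \<ge> 0"
    and sup: "\<And>i. \<bar>v $ i\<bar> \<le> \<beta>" and l1: "l1norm v \<le> k * \<beta>"
  shows "\<bar>g \<bullet> v\<bar> \<le> G * sqrt k * \<beta>"
proof (cases "CARD('d) \<le> k")
  case True
  have "\<beta> \<ge> 0" using sup[of undefined] by simp
  have restr_UNIV: "restr UNIV v = v" by (simp add: restr_def vec_eq_iff)
  \<comment> \<open>No proper choice of \<open>k\<close> entries is available here, but
    \<open>v\<close> itself is \<open>k\<close>-sparse, so the hypothesis applies to it
    directly.\<close>
  have "sparse k v" using sparse_restr[of UNIV k v] True restr_UNIV by simp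
  then have "\<bar>g \<bullet> v\<bar> \<le> G * norm v" by (rule sparse_bound)
  have "(norm v)\<^sup>2 \<le> \<beta> * l1norm v"
    using norm_sq_le_sup_l1[of UNIV v \<beta>] sup restr_UNIV by (simp add: l1norm_def)
  also have "\<dots> \<le> \<beta> * (k * \<beta>)" using l1 \<open>\<beta> \<ge> 0\<close> by (rule mult_left_mono)
  also have "\<dots> = (sqrt k * \<beta>)\<^sup>2" by (simp add: power_mult_distrib power2_eq_square)
  finally have "norm v \<le> sqrt k * \<beta>" by (rule power2_le_imp_le) (use \<open>\<beta> \<ge> 0\<close> in simp)
  then have "G * norm v \<le> G * (sqrt k * \<beta>)" using G by (rule mult_left_mono)
  with \<open>\<bar>g \<bullet> v\<bar> \<le> G * norm v\<close> show ?thesis by simp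
next
  case False
  have "\<beta> \<ge> 0" using sup[of undefined] by simp
  obtain P \<gamma> where P: "card P = k" "\<gamma> \<ge> 0" "\<And>i. i \<in> P \<Longrightarrow> \<gamma> \<le> \<bar>g $ i\<bar>"
      "\<And>i. i \<notin> P \<Longrightarrow> \<bar>g $ i\<bar> \<le> \<gamma>"
    using ex_largest_entries[of k "\<lambda>i. \<bar>g $ i\<bar>"] False by auto
  \<comment> \<open>Testing the hypothesis on the restriction of \<open>g\<close> to
    \<open>P\<close> bounds its norm by \<open>G\<close>, since pairing it with \<open>g\<close>
    gives its squared norm.\<close>
  have "(norm (restr P g))\<^sup>2 \<le> G * norm (restr P g)"
    using sparse_bound[of "restr P g"] sparse_restr[of P k g] P(1) inner_restr_self[of P g]
    by (simp add: inner_commute)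
  then have gP: "norm (restr P g) \<le> G"
    using G by (cases "norm (restr P g) = 0") (auto simp: power2_eq_square)
  have "\<bar>g \<bullet> v\<bar> \<le> (\<Sum>i\<in>UNIV. \<bar>g $ i\<bar> * \<bar>v $ i\<bar>)"
    unfolding inner_vec_def by (rule order_trans[OF sum_abs]) (simp add: abs_mult)
  also have "\<dots> = (\<Sum>i\<in>UNIV. (\<bar>g $ i\<bar> - \<gamma>) * \<bar>v $ i\<bar>) + \<gamma> * l1norm v"
    by (simp add: l1norm_def left_diff_distrib sum_subtractf sum_distrib_left)
  also have "(\<Sum>i\<in>UNIV. (\<bar>g $ i\<bar> - \<gamma>) * \<bar>v $ i\<bar>) \<le> (\<Sum>i\<in>UNIV. if i \<in> P then (\<bar>g $ i\<bar> - \<gamma>) * \<beta> else 0)"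
    using P(3,4) sup by (intro sum_mono) (auto intro!: mult_left_mono simp: mult_nonpos_nonneg)
  also have "\<dots> = \<beta> * (\<Sum>i\<in>P. \<bar>g $ i\<bar>) - \<gamma> * (k * \<beta>)"
    using P(1) by (simp add: sum.If_cases sum_subtractf algebra_simps flip: sum_distrib_right)
      (simp add: sum_distrib_left)
  also have "\<gamma> * l1norm v \<le> \<gamma> * (k * \<beta>)" using l1 P(2) by (rule mult_left_mono)
  finally have "\<bar>g \<bullet> v\<bar> \<le> \<beta> * (\<Sum>i\<in>P. \<bar>g $ i\<bar>)" by simp
  also have "\<dots> \<le> \<beta> * (sqrt k * G)"
  proof (rule mult_left_mono[OF _ \<open>\<beta> \<ge> 0\<close>])
    show "(\<Sum>i\<in>P. \<bar>g $ i\<bar>) \<le> sqrt k * G"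
      using sum_abs_le_sqrt_card[of g P] P(1) mult_left_mono[OF gP, of "sqrt k"] by simp
  qed
  finally show ?thesis by (simp add: mult_ac)
qed

section \<open>The restricted isometry and orthogonality constants satisfy their own
  inequalities\<close>

text \<open>The admissible constants form a closed set (an intersection of closed conditions),
  nonempty and bounded below, so the infimum belongs to it.\<close>

lemma D_RIC_attained:
  fixes A :: "real^'n^'m" and D :: "real^'d^'n"
  shows "D_RIC A D s \<ge> 0"
    and "sparse s v \<Longrightarrow> (1 - D_RIC A D s) * (norm (D *v v))\<^sup>2 \<le> (norm (A *v (D *v v)))\<^sup>2"
    and "sparse s v \<Longrightarrow> (norm (A *v (D *v v)))\<^sup>2 \<le> (1 + D_RIC A D s) * (norm (D *v v))\<^sup>2"
proof -
  define X where "X = {\<delta>. \<delta> \<ge> 0 \<and> (\<forall>v::real^'d. sparse s v \<longrightarrow>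
      (1 - \<delta>) * (norm (D *v v))\<^sup>2 \<le> (norm (A *v (D *v v)))\<^sup>2 \<and>
      (norm (A *v (D *v v)))\<^sup>2 \<le> (1 + \<delta>) * (norm (D *v v))\<^sup>2)}"
  have X_eq: "X = {0..} \<inter> (\<Inter>v\<in>{v. sparse s v}.
      {\<delta>. (1 - \<delta>) * (norm (D *v v))\<^sup>2 \<le> (norm (A *v (D *v v)))\<^sup>2} \<inter>
      {\<delta>. (norm (A *v (D *v v)))\<^sup>2 \<le> (1 + \<delta>) * (norm (D *v v))\<^sup>2})"
    unfolding X_def by auto
  have "closed X" unfolding X_eq
    by (intro closed_Int closed_INT ballI closed_Collect_le closed_atLeast continuous_intros)
  obtain B where B: "B > 0" "\<And>y. norm (A *v y) \<le> norm y * B"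
    using bounded_linear.pos_bounded[of "(*v) A"] by auto
  \<comment> \<open>With \<open>B\<close> an operator bound for \<open>A\<close>, this choice makes
    the lower factor nonpositive, hence the lower inequality trivial, and the upper factor at least
    \<open>B\<^sup>2\<close>.\<close>
  have "1 + B\<^sup>2 \<in> X"
  proof -
    have "(norm (A *v y))\<^sup>2 \<le> (1 + (1 + B\<^sup>2)) * (norm y)\<^sup>2" for y
    proof -
      have "(norm (A *v y))\<^sup>2 \<le> (norm y * B)\<^sup>2" by (rule power_mono[OF B(2)]) simp
      also have "\<dots> = B\<^sup>2 * (norm y)\<^sup>2" by (simp add: power_mult_distrib)
      also have "\<dots> \<le> (1 + (1 + B\<^sup>2)) * (norm y)\<^sup>2" by (intro mult_right_mono) auto
      finally show ?thesis .
    qed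
    moreover have "(1 - (1 + B\<^sup>2)) * (norm y)\<^sup>2 \<le> (norm (A *v y))\<^sup>2" for y :: "real^'n"
      by (rule order_trans[of _ 0]) (auto simp: mult_nonpos_nonneg)
    ultimately show ?thesis unfolding X_def by auto
  qed
  moreover have "bdd_below X" by (rule bdd_belowI[of _ 0]) (simp add: X_def)
  ultimately have "Inf X \<in> X" using \<open>closed X\<close> by (intro closed_contains_Inf) auto
  then have "D_RIC A D s \<in> X" by (simp add: D_RIC_def X_def)
  then show "D_RIC A D s \<ge> 0"
    and "sparse s v \<Longrightarrow> (1 - D_RIC A D s) * (norm (D *v v))\<^sup>2 \<le> (norm (A *v (D *v v)))\<^sup>2"
    and "sparse s v \<Longrightarrow> (norm (A *v (D *v v)))\<^sup>2 \<le> (1 + D_RIC A D s) * (norm (D *v v))\<^sup>2"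
    by (auto simp: X_def)
qed

text \<open>Same closedness argument; an admissible constant comes from Cauchy-Schwarz and operator
  bounds for \<open>D\<close> and for \<open>A\<close> composed with \<open>D\<close>.\<close>

lemma D_ROC_attained:
  fixes A :: "real^'n^'m" and D :: "real^'d^'n"
  shows "D_ROC A D s t \<ge> 0"
    and "sparse s u \<Longrightarrow> sparse t v \<Longrightarrow>
      \<bar>(A *v (D *v u)) \<bullet> (A *v (D *v v)) - (D *v u) \<bullet> (D *v v)\<bar> \<le> D_ROC A D s t * norm u * norm v"
proof -
  define F where "F u v = \<bar>(A *v (D *v u)) \<bullet> (A *v (D *v v)) - (D *v u) \<bullet> (D *v v)\<bar>" for u v
  define X where "X = {\<theta>. \<theta> \<ge> 0 \<and> (\<forall>u v. sparse s u \<longrightarrow> sparse t v \<longrightarrow> F u v \<le> \<theta> * norm u * norm v)}"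
  have X_eq: "X = {0..} \<inter> (\<Inter>u\<in>{u. sparse s u}. \<Inter>v\<in>{v. sparse t v}.
      {\<theta>. F u v \<le> \<theta> * norm u * norm v})"
    unfolding X_def by auto
  have "closed X" unfolding X_eq
    by (intro closed_Int closed_INT ballI closed_Collect_le closed_atLeast continuous_intros)
  obtain B where B: "B > 0" "\<And>y. norm (D *v y) \<le> norm y * B"
    using bounded_linear.pos_bounded[of "(*v) D"] by auto
  obtain B' where B': "B' > 0" "\<And>y. norm (A *v (D *v y)) \<le> norm y * B'"
    using bounded_linear.pos_bounded[of "\<lambda>y. A *v (D *v y)"]
      bounded_linear_compose[OF matrix_vector_mul_bounded_linear matrix_vector_mul_bounded_linear, of A D]
    by auto
  have "B' * B' + B * B \<in> X"
  proof -
    have "F u v \<le> (B' * B' + B * B) * norm u * norm v" for u v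
    proof -
      have "\<bar>(A *v (D *v u)) \<bullet> (A *v (D *v v))\<bar> \<le> (norm u * B') * (norm v * B')"
        by (rule order_trans[OF Cauchy_Schwarz_ineq2]) (intro mult_mono B'(2), use B'(1) in auto)
      moreover have "\<bar>(D *v u) \<bullet> (D *v v)\<bar> \<le> (norm u * B) * (norm v * B)"
        by (rule order_trans[OF Cauchy_Schwarz_ineq2]) (intro mult_mono B(2), use B(1) in auto)
      ultimately show ?thesis unfolding F_def by (simp add: algebra_simps)
    qed
    moreover have "B' * B' + B * B \<ge> 0" by simp
    ultimately show ?thesis unfolding X_def mem_Collect_eq by blast
  qed
  moreover have "bdd_below X" by (rule bdd_belowI[of _ 0]) (simp add: X_def)
  ultimately have "Inf X \<in> X" using \<open>closed X\<close> by (intro closed_contains_Inf) auto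
  then have "D_ROC A D s t \<in> X" by (simp add: D_ROC_def X_def F_def)
  then show "D_ROC A D s t \<ge> 0"
    and "sparse s u \<Longrightarrow> sparse t v \<Longrightarrow>
      \<bar>(A *v (D *v u)) \<bullet> (A *v (D *v v)) - (D *v u) \<bullet> (D *v v)\<bar> \<le> D_ROC A D s t * norm u * norm v"
    by (auto simp: X_def F_def)
qed

section \<open>Tight frames and the restricted estimate\<close>

context
  fixes D :: "real^'d^'n"
  assumes tight: "D ** transpose D = mat 1"
begin

lemma frame_reconstruct: "D *v (transpose D *v y) = y"
  by (simp only: matrix_vector_mul_assoc tight matrix_vector_mul_lid)

lemma frame_norm: "norm (transpose D *v y) = norm y"
proof -
  have "(transpose D *v y) \<bullet> (transpose D *v y) = y \<bullet> y"
    by (metis dot_lmul_matrix frame_reconstruct vector_transpose_matrix transpose_transpose)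
  then show ?thesis by (simp add: norm_eq_sqrt_inner)
qed

lemma frame_synthesis_inner: "(D *v u) \<bullet> y = u \<bullet> (transpose D *v y)"
  by (metis dot_lmul_matrix vector_transpose_matrix transpose_transpose)

text \<open>The adjoint of \<open>D\<close> is an isometry by \<open>frame_norm\<close>, so duality
  makes \<open>D\<close> itself a contraction.\<close>

lemma frame_synthesis_norm_le: "norm (D *v v) \<le> norm v"
proof -
  have "(norm (D *v v))\<^sup>2 = v \<bullet> (transpose D *v (D *v v))"
    by (simp add: power2_norm_eq_inner frame_synthesis_inner)
  also have "\<dots> \<le> norm v * norm (D *v v)"
    using norm_cauchy_schwarz[of v "transpose D *v (D *v v)"] by (simp only: frame_norm)
  finally show ?thesis by (cases "norm (D *v v) = 0") (auto simp: power2_eq_square)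
qed

text \<open>The restricted inequalities are only available for \<open>D u\<close>, whose norm may be strictly smaller
  than that of \<open>u\<close>; but \<open>D u \<bullet> h = u \<bullet> w\<close> recovers the full norm of \<open>u\<close>.\<close>

lemma restricted_norm_bound:
  fixes A :: "real^'n^'m" and h :: "real^'n" and \<beta> :: real and N k :: nat
  defines "w \<equiv> transpose D *v h"
  assumes U: "card U \<le> N"
    and sup: "\<And>i. i \<notin> U \<Longrightarrow> \<bar>w $ i\<bar> \<le> \<beta>" and "\<beta> \<ge> 0" and l1: "(\<Sum>i\<in>-U. \<bar>w $ i\<bar>) \<le> k * \<beta>"
  shows "(1 - D_RIC A D N) * norm (restr U w)
    \<le> sqrt (1 + D_RIC A D N) * norm (A *v h) + D_ROC A D N k * sqrt k * \<beta>"
proof -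
  define u z \<delta> \<theta> where "u = restr U w" and "z = restr (-U) w"
    and "\<delta> = D_RIC A D N" and "\<theta> = D_ROC A D N k"
  note ric = D_RIC_attained[where A = A and D = D and s = N, folded \<delta>_def]
  note roc = D_ROC_attained[where A = A and D = D and s = N and t = k, folded \<theta>_def]
  have spu: "sparse N u" unfolding u_def by (rule sparse_restr[OF U])
  have uz: "D *v u + D *v z = h"
    by (metis frame_reconstruct matrix_vector_right_distrib restr_add_compl u_def w_def z_def)
  \<comment> \<open>Chosen so that pairing with \<open>g\<close> is the orthogonality defect against
    \<open>u\<close>. It is a functional linear in \<open>v\<close>, so its bound on sparse vectors
    extends to the flat vector \<open>z\<close>.\<close>
  define g where "g = transpose D *v (transpose A *v (A *v (D *v u)) - D *v u)"
  have g: "g \<bullet> v = (A *v (D *v u)) \<bullet> (A *v (D *v v)) - (D *v u) \<bullet> (D *v v)" for v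
  proof -
    have "g \<bullet> v = (transpose A *v (A *v (D *v u)) - D *v u) \<bullet> (D *v v)"
      unfolding g_def by (metis frame_synthesis_inner inner_commute)
    also have "\<dots> = (A *v (D *v u)) \<bullet> (A *v (D *v v)) - (D *v u) \<bullet> (D *v v)"
      by (simp add: inner_diff_left)
        (metis dot_lmul_matrix vector_transpose_matrix transpose_transpose)
    finally show ?thesis .
  qed
  have "\<bar>g \<bullet> z\<bar> \<le> (\<theta> * norm u) * sqrt k * \<beta>"
  proof (rule sparse_functional_bound)
    show "\<bar>g \<bullet> v\<bar> \<le> \<theta> * norm u * norm v" if "sparse k v" for v
      unfolding g using roc(2) spu that by blast
    show "\<theta> * norm u \<ge> 0" using roc(1) by simp
    show "\<bar>z $ i\<bar> \<le> \<beta>" for i using sup \<open>\<beta> \<ge> 0\<close> by (simp add: z_def restr_def)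
    show "l1norm z \<le> k * \<beta>" using l1 by (simp add: z_def l1norm_restr)
  qed
  then have cross: "(D *v u) \<bullet> (D *v z) - (A *v (D *v u)) \<bullet> (A *v (D *v z)) \<le> \<theta> * norm u * sqrt k * \<beta>"
    by (simp add: g)
  have "(norm u)\<^sup>2 = (D *v u) \<bullet> h"
    using inner_restr_self[of U w] by (simp add: frame_synthesis_inner u_def w_def)
  also have "\<dots> = (norm (D *v u))\<^sup>2 + (D *v u) \<bullet> (D *v z)"
    by (metis uz inner_add_right power2_norm_eq_inner)
  finally have eq1: "(norm u)\<^sup>2 = (norm (D *v u))\<^sup>2 + (D *v u) \<bullet> (D *v z)" .
  have "(A *v (D *v u)) \<bullet> (A *v h) = (norm (A *v (D *v u)))\<^sup>2 + (A *v (D *v u)) \<bullet> (A *v (D *v z))"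
    by (metis uz inner_add_right power2_norm_eq_inner matrix_vector_right_distrib)
  moreover have "(A *v (D *v u)) \<bullet> (A *v h) \<le> sqrt (1 + \<delta>) * norm u * norm (A *v h)"
  proof -
    have "norm (A *v (D *v u)) \<le> sqrt (1 + \<delta>) * norm (D *v u)"
      by (rule power2_le_imp_le) (use ric(3)[OF spu] ric(1) in \<open>auto simp: power_mult_distrib\<close>)
    also have "\<dots> \<le> sqrt (1 + \<delta>) * norm u"
      using frame_synthesis_norm_le ric(1) by (intro mult_left_mono) auto
    finally show ?thesis
      by (intro order_trans[OF norm_cauchy_schwarz] mult_right_mono) auto
  qed
  \<comment> \<open>Expanding the inner product of \<open>A *v (D *v u)\<close> with
    \<open>A *v h\<close> and using \<open>eq1\<close> gives at least
    \<open>(norm u)\<^sup>2 - \<delta> * (norm (D *v u))\<^sup>2\<close> minus the cross term. Only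
    the product with \<open>\<delta>\<close> still involves \<open>D *v u\<close>, and there the
    contraction goes in the useful direction.\<close>
  moreover have "\<delta> * (norm (D *v u))\<^sup>2 \<le> \<delta> * (norm u)\<^sup>2"
    using ric(1) frame_synthesis_norm_le by (intro mult_left_mono power_mono) auto
  ultimately have "(1 - \<delta>) * (norm u)\<^sup>2
      \<le> sqrt (1 + \<delta>) * norm u * norm (A *v h) + \<theta> * norm u * sqrt k * \<beta>"
    using ric(2)[OF spu] cross eq1 by (simp add: algebra_simps)
  then have "norm u * ((1 - \<delta>) * norm u)
      \<le> norm u * (sqrt (1 + \<delta>) * norm (A *v h) + \<theta> * sqrt k * \<beta>)"
    by (simp add: algebra_simps power2_eq_square)
  \<comment> \<open>Needed for \<open>u = 0\<close>, where the factor \<open>norm u\<close> cannot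
    be cancelled.\<close>
  moreover have "0 \<le> sqrt (1 + \<delta>) * norm (A *v h) + \<theta> * sqrt k * \<beta>"
    using ric(1) roc(1) \<open>\<beta> \<ge> 0\<close> by simp
  ultimately have "(1 - \<delta>) * norm u \<le> sqrt (1 + \<delta>) * norm (A *v h) + \<theta> * sqrt k * \<beta>"
    by (cases "norm u = 0") (auto simp: mult_le_cancel_left_pos)
  then show ?thesis by (simp add: u_def \<delta>_def \<theta>_def)
qed

end

section \<open>The cone condition from minimality\<close>

text \<open>Compare the objective at \<open>xhat\<close> and at \<open>x\<close>. The triangle
  inequality, in opposite directions on \<open>T\<close> and its complement, handles the l1 term.
  Expanding the data term leaves an inner product with the noise, at most
  \<open>lam * norm (A *v h)\<close>. The square of \<open>norm (A *v h)\<close> is kept because it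
  later bounds that norm itself.\<close>

lemma minimizer_cone_bound:
  fixes A :: "real^'n^'m" and D :: "real^'d^'n" and x xhat :: "real^'n"
  assumes "0 < \<alpha>" "lam > 0" "b = A *v x + e" "norm e \<le> lam"
    and min: "objective A D \<alpha> lam b xhat \<le> objective A D \<alpha> lam b x"
  defines "h \<equiv> xhat - x"
  defines "w \<equiv> transpose D *v h"
  shows "(norm (A *v h))\<^sup>2 + 2 * lam * (\<Sum>i\<in>-T. \<bar>w $ i\<bar>)
    \<le> 2 * lam * ((\<Sum>i\<in>T. \<bar>w $ i\<bar>) + \<alpha> * norm w
        + 2 * (\<Sum>i\<in>-T. \<bar>(transpose D *v x) $ i\<bar>) + norm (A *v h))"
proof -
  define y where "y = transpose D *v x"
  have yw: "transpose D *v xhat = y + w"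
    by (simp add: y_def w_def h_def matrix_vector_mult_diff_distrib)
  have split: "l1norm v = (\<Sum>i\<in>T. \<bar>v $ i\<bar>) + (\<Sum>i\<in>-T. \<bar>v $ i\<bar>)" for v :: "real^'d"
    unfolding l1norm_def using sum.Int_Diff[of UNIV "\<lambda>i. \<bar>v $ i\<bar>" T]
    by (simp add: Compl_eq_Diff_UNIV)
  have "(\<Sum>i\<in>T. \<bar>(y + w) $ i\<bar>) \<ge> (\<Sum>i\<in>T. \<bar>y $ i\<bar> - \<bar>w $ i\<bar>)"
    by (rule sum_mono) auto
  moreover have "(\<Sum>i\<in>-T. \<bar>(y + w) $ i\<bar>) \<ge> (\<Sum>i\<in>-T. \<bar>w $ i\<bar> - \<bar>y $ i\<bar>)"
    by (rule sum_mono) auto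
  ultimately have l1: "l1norm (y + w) - l1norm y
      \<ge> (\<Sum>i\<in>-T. \<bar>w $ i\<bar>) - (\<Sum>i\<in>T. \<bar>w $ i\<bar>) - 2 * (\<Sum>i\<in>-T. \<bar>y $ i\<bar>)"
    unfolding split by (simp add: sum_subtractf)
  have l2: "\<alpha> * norm (y + w) \<le> \<alpha> * norm y + \<alpha> * norm w"
    using norm_triangle_ineq[of y w] \<open>0 < \<alpha>\<close> by (simp flip: distrib_left)
  have "A *v xhat - b = A *v h - e" "A *v x - b = - e"
    by (simp_all add: assms(3) h_def matrix_vector_mult_diff_distrib)
  then have "lam * (l1norm (y + w) - \<alpha> * norm (y + w)) + 1/2 * (norm (A *v h - e))\<^sup>2
      \<le> lam * (l1norm y - \<alpha> * norm y) + 1/2 * (norm e)\<^sup>2"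
    using min unfolding objective_def yw y_def[symmetric] by simp
  moreover have "(norm (A *v h - e))\<^sup>2 = (norm (A *v h))\<^sup>2 - 2 * ((A *v h) \<bullet> e) + (norm e)\<^sup>2"
    by (simp add: power2_norm_eq_inner inner_diff_left inner_diff_right inner_commute)
  moreover have "(A *v h) \<bullet> e \<le> lam * norm (A *v h)"
    using norm_cauchy_schwarz[of "A *v h" e] mult_left_mono[OF assms(4), of "norm (A *v h)"]
    by (simp add: mult_ac)
  moreover have "lam * (l1norm (y + w) - \<alpha> * norm (y + w)) - lam * (l1norm y - \<alpha> * norm y)
      \<ge> lam * ((\<Sum>i\<in>-T. \<bar>w $ i\<bar>) - (\<Sum>i\<in>T. \<bar>w $ i\<bar>) - 2 * (\<Sum>i\<in>-T. \<bar>y $ i\<bar>) - \<alpha> * norm w)"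
    unfolding right_diff_distrib[symmetric] using l1 l2 \<open>lam > 0\<close> by (intro mult_left_mono) linarith+
  ultimately show ?thesis by (simp add: y_def algebra_simps)
qed

section \<open>Scalar inequalities behind the constants\<close>

text \<open>A rational substitute for the larger root of the quadratic; its term
  \<open>N / M\<close> produces the quotients by \<open>Q\<close> in the recovery bound.\<close>

lemma quadratic_bound:
  fixes a M N :: real
  assumes "a\<^sup>2 \<le> M * a + N" "M > 0" "N \<ge> 0"
  shows "a \<le> M + N / M"
proof (cases "a \<le> M")
  case True
  then show ?thesis using assms by (simp add: add_increasing2)
next
  case False
  have "M * (a - M) \<le> a * (a - M)" using False by (intro mult_right_mono) auto
  also have "\<dots> \<le> N" using assms(1) by (simp add: algebra_simps power2_eq_square)
  finally show ?thesis using \<open>M > 0\<close> by (simp add: field_simps)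
qed

text \<open>Here \<open>p\<close>, \<open>a\<close> and \<open>r\<close> stand for the norms of the
  main part of \<open>w\<close>, of \<open>A *v h\<close> and of \<open>h\<close>. The first
  estimate bounds \<open>p\<close> affinely in \<open>a\<close>; substitution into the second gives
  a quadratic inequality for \<open>a\<close> alone, and both bounds then enter the third.\<close>

lemma recovery_bound_from_estimates:
  fixes s :: nat
  assumes "s > 0" and "\<alpha> > 0" and "lam > 0" and "tail \<ge> 0" and "\<rho> < 1" and "\<delta> \<ge> 0" and "\<tau> \<ge> 0"
    and C: "C = 1 + (sqrt s + \<alpha>) * \<tau>"
    and p: "(1 - \<rho>) * p \<le> sqrt (1 + \<delta>) * a + \<tau> * (1 - \<rho>) * (2 * tail + a)"
    and a: "a\<^sup>2 \<le> 2 * lam * (a + (sqrt s + \<alpha>) * p + 2 * tail)"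
    and r: "r \<le> (sqrt ((\<alpha> + sqrt s) / sqrt s + \<alpha>\<^sup>2 / (4 * s)) + (\<alpha> + 1) / (2 * sqrt s) + 1) * p
        + (2 * tail + a) / 2"
  shows "r \<le> recovery_bound s \<alpha> \<rho> \<delta> \<tau> C lam tail"
proof -
  define K where "K = sqrt ((\<alpha> + sqrt s) / sqrt s + \<alpha>\<^sup>2 / (4 * s)) + (\<alpha> + 1) / (2 * sqrt s) + 1"
  define d where "d = 1 - \<rho>"
  define E where "E = sqrt (1 + \<delta>)"
  define q where "q = sqrt s + \<alpha>"
  define Q where "Q = C * d + q * E"
  have pos: "d > 0" "E > 0" "q > 0" "C \<ge> 1" using assms by (auto simp: d_def E_def q_def add_nonneg_pos)
  then have "Q > 0" unfolding Q_def by (intro add_pos_pos mult_pos_pos) auto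
  have "K \<ge> 0" unfolding K_def using assms by (intro add_nonneg_nonneg) auto
  have p': "p \<le> \<tau> * (2 * tail) + (\<tau> * d + E) / d * a"
    using p pos(1) unfolding d_def[symmetric] E_def[symmetric] by (simp add: field_simps)
  \<comment> \<open>After substitution the coefficient of \<open>a\<close> is
    \<open>2 * lam * (1 + q * (\<tau> * d + E) / d)\<close>, which is \<open>2 * lam * Q / d\<close>
    because \<open>C = 1 + q * \<tau>\<close>.\<close>
  define M where "M = 2 * lam * (Q / d)"
  have "a\<^sup>2 \<le> 2 * lam * (a + q * p + 2 * tail)" using a by (simp add: q_def)
  also have "\<dots> \<le> 2 * lam * (a + q * (\<tau> * (2 * tail) + (\<tau> * d + E) / d * a) + 2 * tail)"
    using p' pos \<open>lam > 0\<close> by (intro mult_left_mono add_mono order_refl) auto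
  also have "\<dots> = M * a + 2 * lam * C * (2 * tail)"
    using pos unfolding M_def Q_def C q_def[symmetric] by (simp add: field_simps)
  finally have "a \<le> M + 2 * lam * C * (2 * tail) / M"
    using assms pos \<open>Q > 0\<close> by (intro quadratic_bound) (auto simp: M_def)
  also have "2 * lam * C * (2 * tail) / M = C * d / Q * (2 * tail)"
    using pos \<open>lam > 0\<close> \<open>Q > 0\<close> by (simp add: M_def)
  finally have a': "a \<le> C * d / Q * (2 * tail) + M" by simp
  have "r \<le> K * p + (2 * tail + a) / 2" using r by (simp add: K_def)
  also have "\<dots> \<le> K * (\<tau> * (2 * tail) + (\<tau> * d + E) / d * a) + (2 * tail + a) / 2"
    using p' \<open>K \<ge> 0\<close> by (simp add: mult_left_mono)
  also have "\<dots> = (K * \<tau> + 1/2) * (2 * tail) + (K * (\<tau> * d + E) / d + 1/2) * a"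
    using pos by (simp add: field_simps)
  also have "\<dots> \<le> (K * \<tau> + 1/2) * (2 * tail)
      + (K * (\<tau> * d + E) / d + 1/2) * (C * d / Q * (2 * tail) + M)"
    using a' pos \<open>K \<ge> 0\<close> \<open>\<tau> \<ge> 0\<close> by (intro add_left_mono mult_left_mono) auto
  also have "\<dots> = (K * (\<tau> + (\<tau> * d + E) * C / Q) + 1/2 * (1 + C * d / Q)) * 2 * tail
      + (K * (\<tau> * d + E) / d + 1/2) * (Q / d) * 2 * lam"
  proof -
    \<comment> \<open>The factor \<open>d\<close> cancels in \<open>Y * Z\<close>, giving
      \<open>K * W\<close>; with these names the regrouping is a polynomial identity.\<close>
    define Y Z W where "Y = K * (\<tau> * d + E) / d" and "Z = C * d / Q"
      and "W = (\<tau> * d + E) * C / Q"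
    have "Y * Z = K * W" using pos by (simp add: Y_def Z_def W_def)
    have "(K * \<tau> + 1/2) * (2 * tail) + (Y + 1/2) * (Z * (2 * tail) + V)
        = (K * (\<tau> + W) + 1/2 * (1 + Z)) * 2 * tail + (Y + 1/2) * V + (Y * Z - K * W) * (2 * tail)" for V
      by (simp add: algebra_simps)
    from this[of M] \<open>Y * Z = K * W\<close>
    have "(K * \<tau> + 1/2) * (2 * tail) + (Y + 1/2) * (Z * (2 * tail) + M)
        = (K * (\<tau> + W) + 1/2 * (1 + Z)) * 2 * tail + (Y + 1/2) * M" by simp
    moreover have "(Y + 1/2) * M = (Y + 1/2) * (Q / d) * 2 * lam" by (simp only: M_def mult_ac)
    ultimately show ?thesis unfolding Y_def Z_def W_def by (simp only:)
  qed
  also have "Q / d = C + q * E / d" using pos by (simp add: Q_def field_simps)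
  finally show ?thesis
    unfolding recovery_bound_def Let_def K_def[symmetric] d_def[symmetric] E_def[symmetric]
      q_def[symmetric] Q_def[symmetric] .
qed

text \<open>Read \<open>q\<close> as \<open>sqrt s\<close>, \<open>p\<close> and \<open>r\<close> as
  the l2 norms of \<open>w\<close> on and off \<open>S\<close>, and \<open>X\<close> as the l1 norm
  off \<open>S\<close>. AM-GM gives \<open>r \<le> (p + X / q) / 2\<close>, and since
  \<open>\<alpha> \<le> 1\<close> the share of \<open>X\<close> in it can be absorbed on the
  left.\<close>

lemma tail_l1_bound:
  fixes q p r \<alpha> \<eta> X :: real
  assumes "q > 1" "0 < \<alpha>" "\<alpha> \<le> 1" "p \<ge> 0" "r \<ge> 0" "X \<ge> 0" "\<eta> \<ge> 0"
    and r: "r\<^sup>2 \<le> p / q * X" and X: "X \<le> q * p + \<alpha> * (p + r) + \<eta>"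
  shows "X \<le> q * ((sqrt 2 + 1) / (sqrt 2 * (q - 1)) * ((q + \<alpha>) * p + \<eta>))"
proof -
  define Z where "Z = X / q"
  have XZ: "X = q * Z" using assms by (simp add: Z_def)
  have "Z \<ge> 0" using assms by (simp add: Z_def)
  have "r\<^sup>2 \<le> p * Z" using r by (simp add: Z_def)
  also have "\<dots> \<le> ((p + Z) / 2)\<^sup>2"
    using zero_le_power2[of "p - Z"] by (simp add: power2_eq_square field_simps)
  finally have "r \<le> (p + Z) / 2" by (rule power2_le_imp_le) (use \<open>p \<ge> 0\<close> \<open>Z \<ge> 0\<close> in auto)
  then have "\<alpha> * r \<le> \<alpha> * ((p + Z) / 2)" using assms by (intro mult_left_mono) auto
  moreover have "\<alpha> * Z \<le> Z" using mult_right_mono[OF \<open>\<alpha> \<le> 1\<close> \<open>Z \<ge> 0\<close>] by simp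
  ultimately have "(q - 1/2) * Z \<le> (q + 3/2 * \<alpha>) * p + \<eta>"
    using X unfolding XZ by (simp add: algebra_simps)
  \<comment> \<open>Weakened to meet the denominator \<open>sqrt s - 1\<close> of the stated
    constants.\<close>
  moreover have "(q - 1) * Z \<le> (q - 1/2) * Z" using \<open>Z \<ge> 0\<close> by (intro mult_right_mono) auto
  moreover have "(q + 3/2 * \<alpha>) * p + \<eta> \<le> 3/2 * ((q + \<alpha>) * p + \<eta>)"
  proof -
    have "(q + 3/2 * \<alpha>) * p \<le> (3/2 * (q + \<alpha>)) * p"
      using assms by (intro mult_right_mono) auto
    also have "\<dots> = 3/2 * ((q + \<alpha>) * p)" by simp
    finally show ?thesis using \<open>\<eta> \<ge> 0\<close> unfolding distrib_left[of "3/2"] by linarith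
  qed
  moreover have "3/2 * ((q + \<alpha>) * p + \<eta>) \<le> (sqrt 2 + 1) / sqrt 2 * ((q + \<alpha>) * p + \<eta>)"
  proof (intro mult_right_mono)
    have "sqrt 2 \<le> 2" by (rule real_le_lsqrt) auto
    then show "3/2 \<le> (sqrt 2 + 1) / sqrt 2" by (simp add: field_simps)
  qed (use assms in auto)
  ultimately have "(q - 1) * Z \<le> (sqrt 2 + 1) / sqrt 2 * ((q + \<alpha>) * p + \<eta>)" by linarith
  then have "Z \<le> (sqrt 2 + 1) / sqrt 2 * ((q + \<alpha>) * p + \<eta>) / (q - 1)"
    using \<open>q > 1\<close> by (simp add: pos_le_divide_eq mult_ac)
  also have "\<dots> = (sqrt 2 + 1) / (sqrt 2 * (q - 1)) * ((q + \<alpha>) * p + \<eta>)" by simp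
  finally show ?thesis unfolding XZ using \<open>q > 1\<close> by (intro mult_left_mono) auto
qed

text \<open>Complete the square in \<open>r\<close>: this creates the shift
  \<open>\<alpha> * p / (2 * q)\<close> and the summand
  \<open>\<alpha>\<^sup>2 / (4 * q\<^sup>2)\<close>. Subadditivity of the root and AM-GM on
  \<open>p / q * \<eta>\<close> then separate \<open>p\<close> from \<open>\<eta>\<close>.\<close>

lemma tail_l2_bound:
  fixes q p r \<alpha> \<eta> X :: real
  assumes "q > 0" "0 < \<alpha>" "p \<ge> 0" "r \<ge> 0" "\<eta> \<ge> 0"
    and r: "r\<^sup>2 \<le> p / q * X" and X: "X \<le> q * p + \<alpha> * (p + r) + \<eta>"
  shows "r \<le> (sqrt ((\<alpha> + q) / q + \<alpha>\<^sup>2 / (4 * q\<^sup>2)) + (\<alpha> + 1) / (2 * q)) * p + \<eta> / 2"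
proof -
  define c where "c = (\<alpha> + q) / q + \<alpha>\<^sup>2 / (4 * q\<^sup>2)"
  have "c \<ge> 0" using assms by (simp add: c_def)
  have "r\<^sup>2 \<le> p / q * (q * p + \<alpha> * (p + r) + \<eta>)"
    using mult_left_mono[OF X, of "p / q"] r assms by simp
  moreover have "c * p\<^sup>2 + p / q * \<eta> - (r - \<alpha> * p / (2 * q))\<^sup>2
      = p / q * (q * p + \<alpha> * (p + r) + \<eta>) - r\<^sup>2"
    using \<open>q > 0\<close> by (simp add: c_def field_simps power2_eq_square)
  ultimately have "(r - \<alpha> * p / (2 * q))\<^sup>2 \<le> c * p\<^sup>2 + p / q * \<eta>" by linarith
  also have "\<dots> \<le> (sqrt c * p + sqrt (p / q * \<eta>))\<^sup>2"
    using assms \<open>c \<ge> 0\<close> by (simp add: power2_sum power_mult_distrib)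
  finally have "r - \<alpha> * p / (2 * q) \<le> sqrt c * p + sqrt (p / q * \<eta>)"
    by (rule power2_le_imp_le) (use assms \<open>c \<ge> 0\<close> in auto)
  also have "sqrt (p / q * \<eta>) \<le> (p / q + \<eta>) / 2"
    using assms by (intro arith_geo_mean_sqrt) auto
  finally have "r \<le> \<alpha> * p / (2 * q) + sqrt c * p + (p / q + \<eta>) / 2" by simp
  also have "\<dots> = (sqrt c + (\<alpha> + 1) / (2 * q)) * p + \<eta> / 2"
    using \<open>q > 0\<close> by (simp add: field_simps)
  finally show ?thesis by (simp add: c_def)
qed

section \<open>Estimates for the error vector and the choice of supports\<close>

context
  fixes A :: "real^'n^'m" and D :: "real^'d^'n" and x xhat :: "real^'n"
    and e b :: "real^'m" and \<alpha> lam :: real and s :: nat and T :: "'d set"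
    and h :: "real^'n" and w :: "real^'d" and tail \<eta> c :: real
  assumes DDt: "D ** transpose D = mat 1"
    and alpha: "0 < \<alpha>" "\<alpha> \<le> 1"
    and lam: "lam > 0"
    and s2: "s \<ge> 2"
    and bdef: "b = A *v x + e"
    and enorm: "norm e \<le> lam"
    and Tcard: "card T = s"
    and xhat_min: "\<forall>z. objective A D \<alpha> lam b xhat \<le> objective A D \<alpha> lam b z"
  defines "h \<equiv> xhat - x"
    and "w \<equiv> transpose D *v h"
    and "tail \<equiv> (\<Sum>i\<in>-T. \<bar>(transpose D *v x) $ i\<bar>)"
    and "\<eta> \<equiv> 2 * tail + norm (A *v h)"
    and "c \<equiv> (sqrt 2 + 1) / (sqrt 2 * (sqrt s - 1))"
begin

lemma sqrt_s_gt_1: "sqrt s > 1"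
  using s2 by simp

lemma tail_nonneg: "tail \<ge> 0"
  by (simp add: tail_def sum_nonneg)

text \<open>Both fractions composing the product are at least 1. This lets the l1 tail estimate
  dominate the entrywise one when the order is \<open>s\<close>.\<close>

lemma c_ge: "1 \<le> c * (sqrt s + \<alpha>)"
proof -
  have "1 \<le> (sqrt s + \<alpha>) / (sqrt s - 1)" using sqrt_s_gt_1 alpha by (simp add: field_simps)
  moreover have "1 \<le> (sqrt 2 + 1) / sqrt (2::real)" by simp
  ultimately have "1 * 1 \<le> (sqrt 2 + 1) / sqrt 2 * ((sqrt s + \<alpha>) / (sqrt s - 1))"
    by (intro mult_mono) auto
  then show ?thesis by (simp add: c_def)
qed

lemma c_nonneg: "c \<ge> 0"
  using sqrt_s_gt_1 by (simp add: c_def)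

text \<open>The cone condition is given for \<open>T\<close>, but flatness of the tail requires the
  \<open>s\<close> largest entries of \<open>w\<close>. Passing to them enlarges the sum inside and
  shrinks the sum outside, so the cone condition survives.\<close>

lemma largest_entries_estimates:
  obtains S where "card S = s"
    and "\<And>i. i \<notin> S \<Longrightarrow> \<bar>w $ i\<bar> \<le> norm (restr S w) / sqrt s"
    and "(\<Sum>i\<in>-S. \<bar>w $ i\<bar>) \<le> sqrt s * (c * ((sqrt s + \<alpha>) * norm (restr S w) + \<eta>))"
    and "(norm (A *v h))\<^sup>2
        \<le> 2 * lam * (norm (A *v h) + (sqrt s + \<alpha>) * norm (restr S w) + 2 * tail)"
    and "norm h \<le> (sqrt ((\<alpha> + sqrt s) / sqrt s + \<alpha>\<^sup>2 / (4 * s)) + (\<alpha> + 1) / (2 * sqrt s) + 1)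
        * norm (restr S w) + \<eta> / 2"
proof -
  have "s \<le> CARD('d)" using Tcard card_mono[of UNIV T] by simp
  then obtain S \<gamma> where S: "card S = s" "\<gamma> \<ge> 0" "\<And>i. i \<in> S \<Longrightarrow> \<gamma> \<le> \<bar>w $ i\<bar>"
      "\<And>i. i \<notin> S \<Longrightarrow> \<bar>w $ i\<bar> \<le> \<gamma>"
    using ex_largest_entries[of s "\<lambda>i. \<bar>w $ i\<bar>"] by auto
  define p r X q where "p = norm (restr S w)" and "r = norm (restr (-S) w)"
    and "X = (\<Sum>i\<in>-S. \<bar>w $ i\<bar>)" and "q = sqrt s"
  have q: "q > 1" "q\<^sup>2 = s" using sqrt_s_gt_1 by (auto simp: q_def)
  have nn: "p \<ge> 0" "r \<ge> 0" "X \<ge> 0" "\<eta> \<ge> 0"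
    using tail_nonneg by (auto simp: p_def r_def X_def \<eta>_def sum_nonneg)
  have split: "(\<Sum>i\<in>UNIV. f i) = (\<Sum>i\<in>V. f i) + (\<Sum>i\<in>-V. f i)" for f :: "'d \<Rightarrow> real" and V
    using sum.Int_Diff[of UNIV f V] by (simp add: Compl_eq_Diff_UNIV)
  have ST: "(\<Sum>i\<in>T. \<bar>w $ i\<bar>) \<le> (\<Sum>i\<in>S. \<bar>w $ i\<bar>)"
    by (rule sum_le_sum_largest[of _ _ \<gamma>]) (use S Tcard in auto)
  have Sp: "(\<Sum>i\<in>S. \<bar>w $ i\<bar>) \<le> q * p"
    using sum_abs_le_sqrt_card[of w S] S(1) by (simp add: p_def q_def)
  \<comment> \<open>The threshold is at most the average of the \<open>s\<close> largest entries,
    hence at most \<open>p / q\<close> by Cauchy-Schwarz.\<close>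
  have "s * \<gamma> \<le> (\<Sum>i\<in>S. \<bar>w $ i\<bar>)"
    using sum_bounded_below[of S \<gamma> "\<lambda>i. \<bar>w $ i\<bar>"] S by simp
  then have "q * (q * \<gamma>) \<le> q * p" using Sp q(2) by (simp add: power2_eq_square flip: mult.assoc)
  then have \<gamma>: "\<gamma> \<le> p / q" using q(1) by (simp add: pos_le_divide_eq mult_ac)
  have sup: "\<bar>w $ i\<bar> \<le> p / q" if "i \<notin> S" for i using S(4)[OF that] \<gamma> by simp
  have r2: "r\<^sup>2 \<le> p / q * X"
    unfolding r_def X_def by (rule norm_sq_le_sup_l1) (use sup in auto)
  have nw: "norm w \<le> p + r"
    using norm_triangle_ineq[of "restr S w" "restr (-S) w"] by (simp add: restr_add_compl p_def r_def)
  have rX: "r \<le> X"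
    using norm_le_l1_cart[of "restr (-S) w"] l1norm_restr[of "-S" w]
    by (simp add: r_def X_def l1norm_def)
  have "(norm (A *v h))\<^sup>2 + 2 * lam * (\<Sum>i\<in>-T. \<bar>w $ i\<bar>)
      \<le> 2 * lam * ((\<Sum>i\<in>T. \<bar>w $ i\<bar>) + \<alpha> * norm w + 2 * tail + norm (A *v h))"
    unfolding h_def w_def tail_def
    using minimizer_cone_bound[OF alpha(1) lam bdef enorm] xhat_min by blast
  moreover have "X \<le> (\<Sum>i\<in>-T. \<bar>w $ i\<bar>)"
    using ST split[of "\<lambda>i. \<bar>w $ i\<bar>" T] split[of "\<lambda>i. \<bar>w $ i\<bar>" S] by (simp add: X_def)
  then have "2 * lam * X \<le> 2 * lam * (\<Sum>i\<in>-T. \<bar>w $ i\<bar>)" using lam by simp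
  moreover have "2 * lam * ((\<Sum>i\<in>T. \<bar>w $ i\<bar>) + \<alpha> * norm w + 2 * tail + norm (A *v h))
      \<le> 2 * lam * (q * p + \<alpha> * (p + r) + \<eta>)"
    using ST Sp nw alpha lam unfolding \<eta>_def
    by (intro mult_left_mono) (auto intro: order_trans add_mono mult_left_mono)
  ultimately have cone: "(norm (A *v h))\<^sup>2 + 2 * lam * X \<le> 2 * lam * (q * p + \<alpha> * (p + r) + \<eta>)"
    by linarith
  then have "2 * lam * X \<le> 2 * lam * (q * p + \<alpha> * (p + r) + \<eta>)"
    using zero_le_power2[of "norm (A *v h)"] by linarith
  then have X: "X \<le> q * p + \<alpha> * (p + r) + \<eta>" using lam by simp
  \<comment> \<open>The l1 tail on the left of the cone condition pays for
    \<open>\<alpha> * r\<close> on the right, leaving an inequality in \<open>p\<close> and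
    \<open>norm (A *v h)\<close> only.\<close>
  have "\<alpha> * r \<le> X" using rX alpha nn mult_left_le_one_le[of r \<alpha>] by linarith
  then have "2 * lam * (q * p + \<alpha> * (p + r) + \<eta> - X) \<le> 2 * lam * ((q + \<alpha>) * p + \<eta>)"
    using lam by (intro mult_left_mono) (auto simp: algebra_simps)
  then have a: "(norm (A *v h))\<^sup>2 \<le> 2 * lam * (norm (A *v h) + (q + \<alpha>) * p + 2 * tail)"
    using cone by (simp add: \<eta>_def algebra_simps)
  have "norm h \<le> p + r" using nw frame_norm[OF DDt] by (simp only: w_def)
  also have "r \<le> (sqrt ((\<alpha> + q) / q + \<alpha>\<^sup>2 / (4 * q\<^sup>2)) + (\<alpha> + 1) / (2 * q)) * p + \<eta> / 2"
    by (rule tail_l2_bound[OF _ _ _ _ _ r2 X]) (use q alpha nn in auto)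
  finally have "norm h \<le> (sqrt ((\<alpha> + q) / q + \<alpha>\<^sup>2 / (4 * s)) + (\<alpha> + 1) / (2 * q) + 1) * p + \<eta> / 2"
    by (simp add: q(2) distrib_right)
  moreover have "X \<le> q * (c * ((q + \<alpha>) * p + \<eta>))"
    unfolding c_def q_def[symmetric]
    by (rule tail_l1_bound[OF _ _ _ _ _ _ _ r2 X]) (use q alpha nn in auto)
  ultimately show thesis
    using that[of S] S(1) sup a unfolding p_def q_def X_def by blast
qed

text \<open>Common end of both regimes. \<open>G\<close> is the coefficient left by the
  orthogonality term; its share of \<open>norm (restr U w)\<close> is moved to the left and merged
  into \<open>\<rho>\<close>, while its share of \<open>\<eta>\<close> becomes
  \<open>\<tau> * (1 - \<rho>)\<close>. Enlarging \<open>S\<close> to \<open>U\<close> only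
  increases the norm, so the estimates for \<open>S\<close> carry over.\<close>

lemma recovery_from_support:
  fixes N k :: nat and \<beta> G \<rho> \<tau> C :: real
  assumes est: "(norm (A *v h))\<^sup>2
        \<le> 2 * lam * (norm (A *v h) + (sqrt s + \<alpha>) * norm (restr S w) + 2 * tail)"
      "norm h \<le> (sqrt ((\<alpha> + sqrt s) / sqrt s + \<alpha>\<^sup>2 / (4 * s)) + (\<alpha> + 1) / (2 * sqrt s) + 1)
        * norm (restr S w) + \<eta> / 2"
    and U: "S \<subseteq> U" "card U \<le> N"
    and sup: "\<And>i. i \<notin> U \<Longrightarrow> \<bar>w $ i\<bar> \<le> \<beta>" and "\<beta> \<ge> 0" and l1: "(\<Sum>i\<in>-U. \<bar>w $ i\<bar>) \<le> k * \<beta>"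
    and G: "G \<ge> 0" "D_ROC A D N k * sqrt k * \<beta> \<le> G * ((sqrt s + \<alpha>) * norm (restr S w) + \<eta>)"
    and \<rho>: "D_RIC A D N + G * (sqrt s + \<alpha>) \<le> \<rho>" "\<rho> < 1"
    and \<tau>: "\<tau> = G / (1 - \<rho>)" and C: "C = 1 + (sqrt s + \<alpha>) * \<tau>"
  shows "norm h \<le> recovery_bound s \<alpha> \<rho> (D_RIC A D N) \<tau> C lam tail"
proof (rule recovery_bound_from_estimates[where p = "norm (restr U w)" and a = "norm (A *v h)"])
  define p where "p = norm (restr U w)"
  have "(norm (restr S w))\<^sup>2 \<le> p\<^sup>2"
    unfolding p_def norm_restr_sq by (rule sum_mono2) (use U in auto)
  then have Sp: "norm (restr S w) \<le> p" by (rule power2_le_imp_le) (simp add: p_def)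
  have q: "sqrt s + \<alpha> \<ge> 0" using alpha by simp
  show "(1 - \<rho>) * norm (restr U w)
      \<le> sqrt (1 + D_RIC A D N) * norm (A *v h) + \<tau> * (1 - \<rho>) * (2 * tail + norm (A *v h))"
  proof -
    have "(1 - D_RIC A D N) * p \<le> sqrt (1 + D_RIC A D N) * norm (A *v h) + D_ROC A D N k * sqrt k * \<beta>"
      unfolding p_def w_def
      by (rule restricted_norm_bound[OF DDt U(2)]) (use sup l1 \<open>\<beta> \<ge> 0\<close> in \<open>auto simp only: w_def\<close>)
    moreover have "G * ((sqrt s + \<alpha>) * norm (restr S w) + \<eta>) \<le> G * ((sqrt s + \<alpha>) * p + \<eta>)"
      using Sp G(1) q by (intro mult_left_mono add_mono order_refl)
    moreover have "(D_RIC A D N + G * (sqrt s + \<alpha>)) * p \<le> \<rho> * p"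
      using \<rho>(1) by (intro mult_right_mono) (auto simp: p_def)
    ultimately have "(1 - \<rho>) * p \<le> sqrt (1 + D_RIC A D N) * norm (A *v h) + G * \<eta>"
      using G(2) by (simp add: algebra_simps)
    moreover have "\<tau> * (1 - \<rho>) = G" using \<rho>(2) by (simp add: \<tau>)
    ultimately show ?thesis by (simp only: p_def \<eta>_def)
  qed
  show "(norm (A *v h))\<^sup>2 \<le> 2 * lam * (norm (A *v h) + (sqrt s + \<alpha>) * norm (restr U w) + 2 * tail)"
  proof -
    have "2 * lam * ((sqrt s + \<alpha>) * norm (restr S w)) \<le> 2 * lam * ((sqrt s + \<alpha>) * p)"
      using Sp q lam by (intro mult_left_mono) auto
    then show ?thesis using est(1) by (simp only: p_def distrib_left)
  qed
  show "norm h \<le> (sqrt ((\<alpha> + sqrt s) / sqrt s + \<alpha>\<^sup>2 / (4 * s)) + (\<alpha> + 1) / (2 * sqrt s) + 1)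
      * norm (restr U w) + (2 * tail + norm (A *v h)) / 2"
    using Sp alpha unfolding p_def \<eta>_def[symmetric]
    by (intro order_trans[OF est(2)] mult_right_mono mult_left_mono add_mono order_refl) auto
qed (use s2 alpha lam tail_nonneg \<rho>(2) D_RIC_attained(1) G(1) C \<tau> in auto)

text \<open>The support is not enlarged: \<open>U = S\<close> and \<open>k = s\<close>.\<close>

lemma recovery_order_s:
  fixes \<rho> \<tau> C :: real
  defines "\<theta> \<equiv> D_ROC A D s s"
  assumes \<rho>: "D_RIC A D s + c * \<theta> * (sqrt s + \<alpha>) \<le> \<rho>" "\<rho> < 1"
    and \<tau>: "\<tau> = c * \<theta> / (1 - \<rho>)" and C: "C = 1 + (sqrt s + \<alpha>) * \<tau>"
  shows "norm h \<le> recovery_bound s \<alpha> \<rho> (D_RIC A D s) \<tau> C lam tail"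
proof -
  from largest_entries_estimates obtain S where S: "card S = s"
    and sup: "\<And>i. i \<notin> S \<Longrightarrow> \<bar>w $ i\<bar> \<le> norm (restr S w) / sqrt s"
    and X: "(\<Sum>i\<in>-S. \<bar>w $ i\<bar>) \<le> sqrt s * (c * ((sqrt s + \<alpha>) * norm (restr S w) + \<eta>))"
    and est: "(norm (A *v h))\<^sup>2
        \<le> 2 * lam * (norm (A *v h) + (sqrt s + \<alpha>) * norm (restr S w) + 2 * tail)"
      "norm h \<le> (sqrt ((\<alpha> + sqrt s) / sqrt s + \<alpha>\<^sup>2 / (4 * s)) + (\<alpha> + 1) / (2 * sqrt s) + 1)
        * norm (restr S w) + \<eta> / 2" by metis
  \<comment> \<open>With \<open>\<beta> = B / sqrt s\<close> the l1 bound is exactly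
    \<open>s * \<beta>\<close>; \<open>pB\<close> ensures that \<open>\<beta>\<close> also dominates
    every entry off \<open>S\<close>.\<close>
  define B where "B = c * ((sqrt s + \<alpha>) * norm (restr S w) + \<eta>)"
  have "\<eta> \<ge> 0" using tail_nonneg by (simp add: \<eta>_def)
  have pB: "norm (restr S w) \<le> B"
  proof -
    have "norm (restr S w) \<le> c * (sqrt s + \<alpha>) * norm (restr S w)"
      using mult_right_mono[OF c_ge, of "norm (restr S w)"] by simp
    also have "\<dots> \<le> c * (sqrt s + \<alpha>) * norm (restr S w) + c * \<eta>"
      using c_nonneg \<open>\<eta> \<ge> 0\<close> by simp
    finally show ?thesis by (simp add: B_def algebra_simps)
  qed
  show ?thesis
  proof (rule recovery_from_support[OF est order_refl, where \<beta> = "B / sqrt s" and k = s])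
    show "\<bar>w $ i\<bar> \<le> B / sqrt s" if "i \<notin> S" for i
      by (rule order_trans[OF sup[OF that] divide_right_mono[OF pB]]) simp
    show "B / sqrt s \<ge> 0" using order_trans[OF norm_ge_zero pB] by simp
    have "s * (B / sqrt s) = (s / sqrt s) * B" by simp
    also have "\<dots> = sqrt s * B" by (simp only: real_div_sqrt[OF of_nat_0_le_iff])
    finally show "(\<Sum>i\<in>-S. \<bar>w $ i\<bar>) \<le> s * (B / sqrt s)" using X by (simp only: B_def)
    show "D_ROC A D s s * sqrt s * (B / sqrt s)
        \<le> (c * \<theta>) * ((sqrt s + \<alpha>) * norm (restr S w) + \<eta>)"
      using s2 by (simp add: \<theta>_def B_def)
    show "c * \<theta> \<ge> 0" unfolding \<theta>_def by (intro mult_nonneg_nonneg c_nonneg D_ROC_attained(1))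
  qed (use S \<rho> \<tau> C in \<open>auto simp: mult.assoc\<close>)
qed

text \<open>Moving the entries above the average level \<open>X / k\<close> into the support leaves
  a flatter tail and costs at most \<open>k\<close> further indices. This gains the factor
  \<open>1 / sqrt (t - 1)\<close>.\<close>

lemma recovery_order_ts:
  fixes t \<rho> \<tau> C :: real and N k :: nat
  assumes t: "t > 1" and N: "N = nat \<lceil>t * s\<rceil>" and k: "k = nat \<lceil>(t - 1) * s\<rceil>"
  defines "\<theta> \<equiv> D_ROC A D N k"
  assumes \<rho>: "D_RIC A D N + sqrt (k / ((t - 1)\<^sup>2 * s)) * c * (sqrt s + \<alpha>) * \<theta> \<le> \<rho>" "\<rho> < 1"
    and \<tau>: "\<tau> = c * \<theta> / sqrt (t - 1) / (1 - \<rho>)" and C: "C = 1 + (sqrt s + \<alpha>) * \<tau>"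
  shows "norm h \<le> recovery_bound s \<alpha> \<rho> (D_RIC A D N) \<tau> C lam tail"
proof -
  from largest_entries_estimates obtain S where S: "card S = s"
    and X0: "(\<Sum>i\<in>-S. \<bar>w $ i\<bar>) \<le> sqrt s * (c * ((sqrt s + \<alpha>) * norm (restr S w) + \<eta>))"
    and est: "(norm (A *v h))\<^sup>2
        \<le> 2 * lam * (norm (A *v h) + (sqrt s + \<alpha>) * norm (restr S w) + 2 * tail)"
      "norm h \<le> (sqrt ((\<alpha> + sqrt s) / sqrt s + \<alpha>\<^sup>2 / (4 * s)) + (\<alpha> + 1) / (2 * sqrt s) + 1)
        * norm (restr S w) + \<eta> / 2" by metis
  define X where "X = (\<Sum>i\<in>-S. \<bar>w $ i\<bar>)"
  have "X \<ge> 0" by (simp add: X_def sum_nonneg)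
  have ts: "(t - 1) * s > 0" using t s2 by simp
  have kge: "(t - 1) * s \<le> k" unfolding k by linarith
  then have "k > 0" using ts by (metis less_le_trans of_nat_0_less_iff)
  \<comment> \<open>Since \<open>s\<close> is an integer, the two ceilings differ by exactly
    \<open>s\<close>, so \<open>S\<close> and \<open>k\<close> further indices fit into order
    \<open>N\<close>.\<close>
  have "t * s = (t - 1) * s + of_int (int s)" by (simp add: algebra_simps)
  then have "\<lceil>t * s\<rceil> = \<lceil>(t - 1) * s\<rceil> + int s" by (simp only: ceiling_add_of_int)
  then have Nk: "N = k + s" using ts by (simp add: N k nat_add_distrib)
  define V where "V = {i. i \<notin> S \<and> X / k < \<bar>w $ i\<bar>}"
  have cV: "card V \<le> k"
  \<comment> \<open>Counting divides by \<open>X\<close>. If \<open>X = 0\<close>, all entries off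
    \<open>S\<close> vanish, and the strict inequality in \<open>V\<close> makes it empty.\<close>
  proof (cases "X = 0")
    case True
    then have "\<forall>i\<in>-S. \<bar>w $ i\<bar> = 0" unfolding X_def by (subst (asm) sum_nonneg_eq_0_iff) auto
    then have "V = {}" using True by (auto simp: V_def)
    then show ?thesis by simp
  next
    case False
    have "card V * (X / k) \<le> (\<Sum>i\<in>V. \<bar>w $ i\<bar>)"
      by (rule sum_bounded_below) (auto simp: V_def)
    also have "\<dots> \<le> X" unfolding X_def by (rule sum_mono2) (auto simp: V_def)
    finally show ?thesis using \<open>k > 0\<close> False \<open>X \<ge> 0\<close> by (simp add: field_simps)
  qed
  \<comment> \<open>\<open>\<rho>\<close> carries the rounded order \<open>k\<close>, whereas
    \<open>\<tau>\<close> has the exact factor \<open>1 / sqrt (t - 1)\<close>; rounding up makes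
    the coefficient in \<open>\<rho>\<close> the larger one.\<close>
  have mono: "c * \<theta> / sqrt (t - 1) \<le> sqrt (k / ((t - 1)\<^sup>2 * s)) * c * \<theta>"
  proof -
    have "1 / (t - 1) = (t - 1) * s / ((t - 1)\<^sup>2 * s)"
      using t s2 by (simp add: power2_eq_square)
    also have "\<dots> \<le> k / ((t - 1)\<^sup>2 * s)" using kge by (intro divide_right_mono) auto
    finally have "1 / sqrt (t - 1) \<le> sqrt (k / ((t - 1)\<^sup>2 * s))"
      by (metis real_sqrt_divide real_sqrt_le_mono real_sqrt_one)
    then have "1 / sqrt (t - 1) * (c * \<theta>) \<le> sqrt (k / ((t - 1)\<^sup>2 * s)) * (c * \<theta>)"
      using c_nonneg D_ROC_attained(1)[where A = A and D = D and s = N and t = k] by (intro mult_right_mono) (auto simp: \<theta>_def)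
    then show ?thesis by (simp add: mult.assoc)
  qed
  show ?thesis
  proof (rule recovery_from_support[OF est, where U = "S \<union> V" and \<beta> = "X / k" and k = k])
    show "card (S \<union> V) \<le> N" using card_Un_le[of S V] S cV Nk by simp
    show "\<bar>w $ i\<bar> \<le> X / k" if "i \<notin> S \<union> V" for i using that by (auto simp: V_def)
    show "X / k \<ge> 0" using \<open>X \<ge> 0\<close> by simp
    have "(\<Sum>i\<in>-(S \<union> V). \<bar>w $ i\<bar>) \<le> X" unfolding X_def by (rule sum_mono2) auto
    then show "(\<Sum>i\<in>-(S \<union> V). \<bar>w $ i\<bar>) \<le> k * (X / k)" using \<open>k > 0\<close> by simp
    show "c * \<theta> / sqrt (t - 1) \<ge> 0"
      using c_nonneg D_ROC_attained(1)[where A = A and D = D and s = N and t = k] t by (simp add: \<theta>_def)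
    show "D_ROC A D N k * sqrt k * (X / k)
        \<le> c * \<theta> / sqrt (t - 1) * ((sqrt s + \<alpha>) * norm (restr S w) + \<eta>)"
    proof -
      have "sqrt k * (X / k) = X / sqrt k"
        using \<open>k > 0\<close> by (simp add: field_simps flip: real_sqrt_mult)
      also have "\<dots> \<le> X / sqrt ((t - 1) * s)"
        using kge ts \<open>X \<ge> 0\<close> by (intro divide_left_mono) auto
      also have "\<dots> \<le> sqrt s * (c * ((sqrt s + \<alpha>) * norm (restr S w) + \<eta>)) / sqrt ((t - 1) * s)"
        using X0 ts by (intro divide_right_mono) (auto simp: X_def)
      also have "\<dots> = c * ((sqrt s + \<alpha>) * norm (restr S w) + \<eta>) / sqrt (t - 1)"
        using s2 by (simp add: real_sqrt_mult)
      finally have "\<theta> * (sqrt k * (X / k))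
          \<le> \<theta> * (c * ((sqrt s + \<alpha>) * norm (restr S w) + \<eta>) / sqrt (t - 1))"
        using D_ROC_attained(1)[where A = A and D = D and s = N and t = k] by (intro mult_left_mono) (auto simp: \<theta>_def)
      then show ?thesis by (simp add: \<theta>_def mult_ac)
    qed
    show "D_RIC A D N + c * \<theta> / sqrt (t - 1) * (sqrt s + \<alpha>) \<le> \<rho>"
      using mult_right_mono[OF mono, of "sqrt s + \<alpha>"] alpha \<rho>(1) by (simp add: mult_ac)
  qed (use \<rho> \<tau> C in auto)
qed

end

section \<open>Matching the stated constants in the two regimes\<close>

theorem theorem1:
  fixes A :: "real^'n^'m" and D :: "real^'d^'n" and x xhat :: "real^'n"
    and e b :: "real^'m" and \<alpha> lam :: real and s :: nat and T :: "'d set"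
  assumes DDt: "D ** transpose D = mat 1"
    and alpha: "0 < \<alpha>" "\<alpha> \<le> 1"
    and lam: "lam > 0"
    and s2: "s \<ge> 2"
    and bdef: "b = A *v x + e"
    and enorm: "norm e \<le> lam"
    and Tcard: "card T = s"
    and Tlargest: "\<forall>i\<in>T. \<forall>j. j \<notin> T \<longrightarrow> \<bar>(transpose D *v x) $ j\<bar> \<le> \<bar>(transpose D *v x) $ i\<bar>"
    and xhat_min: "\<forall>z. objective A D \<alpha> lam b xhat \<le> objective A D \<alpha> lam b z"
  shows
    "(\<forall>t::real. t \<ge> 3 \<longrightarrow>
       (let \<delta> = D_RIC A D (nat \<lceil>t * s\<rceil>);
            \<theta> = D_ROC A D (nat \<lceil>t * s\<rceil>) (nat \<lceil>(t - 1) * s\<rceil>);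
            \<rho> = \<delta> + sqrt (real (nat \<lceil>(t - 1) * s\<rceil>) / ((t - 1)\<^sup>2 * s))
                   * ((sqrt 2 + 1) * (sqrt s + \<alpha>)) / (sqrt 2 * (sqrt s - 1)) * \<theta>;
            \<tau> = (sqrt 2 + 1) * \<theta> / (sqrt 2 * (1 - \<rho>))
                   * sqrt ((t - 1) * s) / ((t - 1) * (s - sqrt s));
            C = 1 + (sqrt 2 + 1) * \<theta> / (sqrt 2 * (1 - \<rho>))
                   * (sqrt s + \<alpha>) / (s - sqrt s) * sqrt ((t - 1) * s) / (t - 1)
        in \<rho> < 1 \<longrightarrow>
           norm (xhat - x) \<le> recovery_bound s \<alpha> \<rho> \<delta> \<tau> C lam
             (\<Sum>i\<in>- T. \<bar>(transpose D *v x) $ i\<bar>)))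
   \<and>
    (let \<delta> = D_RIC A D s;
         \<theta> = D_ROC A D s s;
         \<rho> = \<delta> + (sqrt 2 + 1) * (sqrt s + \<alpha>) / (sqrt 2 * (sqrt s - 1)) * \<theta>;
         \<tau> = (sqrt 2 + 1) * \<theta> / (sqrt 2 * (1 - \<rho>)) * (1 / (sqrt s - 1));
         C = 1 + (sqrt 2 + 1) * \<theta> / (sqrt 2 * (1 - \<rho>)) * (sqrt s + \<alpha>) / (sqrt s - 1)
     in \<rho> < 1 \<longrightarrow>
        norm (xhat - x) \<le> recovery_bound s \<alpha> \<rho> \<delta> \<tau> C lam
          (\<Sum>i\<in>- T. \<bar>(transpose D *v x) $ i\<bar>))"
proof (intro conjI allI impI)
  have q: "sqrt s > 1" using s2 by simp
  have s_q: "s - sqrt s = sqrt s * (sqrt s - 1)" by (simp add: right_diff_distrib)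
  fix t :: real assume "t \<ge> 3"
  then have t: "t > 1" by simp
  have "sqrt ((t - 1) * s) / (t - 1) = sqrt (t - 1) / (t - 1) * sqrt s"
    by (simp add: real_sqrt_mult)
  also have "\<dots> = sqrt s / sqrt (t - 1)"
    using t by (subst sqrt_divide_self_eq) (auto simp: divide_inverse mult.commute)
  finally have coef: "sqrt ((t - 1) * s) / (t - 1) = sqrt s / sqrt (t - 1)" .
  \<comment> \<open>The root of \<open>s\<close> from \<open>coef\<close> cancels against
    \<open>s - sqrt s = sqrt s * (sqrt s - 1)\<close>, leaving the form of \<open>\<tau>\<close>
    used in \<open>recovery_order_ts\<close>.\<close>
  have \<tau>: "P * \<theta> / (sqrt 2 * R) * sqrt ((t - 1) * s) / ((t - 1) * (s - sqrt s))
      = P / (sqrt 2 * (sqrt s - 1)) * \<theta> / sqrt (t - 1) / R" for P R \<theta>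
  proof -
    have "P * \<theta> / (sqrt 2 * R) * sqrt ((t - 1) * s) / ((t - 1) * (s - sqrt s))
        = P * \<theta> / (sqrt 2 * R * (s - sqrt s)) * (sqrt ((t - 1) * s) / (t - 1))"
      by (simp add: mult_ac)
    also have "\<dots> = P / (sqrt 2 * (sqrt s - 1)) * \<theta> / sqrt (t - 1) / R"
      unfolding coef s_q using q by (simp add: mult_ac)
    finally show ?thesis .
  qed
  show "let \<delta> = D_RIC A D (nat \<lceil>t * s\<rceil>);
            \<theta> = D_ROC A D (nat \<lceil>t * s\<rceil>) (nat \<lceil>(t - 1) * s\<rceil>);
            \<rho> = \<delta> + sqrt (real (nat \<lceil>(t - 1) * s\<rceil>) / ((t - 1)\<^sup>2 * s))
                   * ((sqrt 2 + 1) * (sqrt s + \<alpha>)) / (sqrt 2 * (sqrt s - 1)) * \<theta>;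
            \<tau> = (sqrt 2 + 1) * \<theta> / (sqrt 2 * (1 - \<rho>))
                   * sqrt ((t - 1) * s) / ((t - 1) * (s - sqrt s));
            C = 1 + (sqrt 2 + 1) * \<theta> / (sqrt 2 * (1 - \<rho>))
                   * (sqrt s + \<alpha>) / (s - sqrt s) * sqrt ((t - 1) * s) / (t - 1)
        in \<rho> < 1 \<longrightarrow>
           norm (xhat - x) \<le> recovery_bound s \<alpha> \<rho> \<delta> \<tau> C lam
             (\<Sum>i\<in>- T. \<bar>(transpose D *v x) $ i\<bar>)"
    unfolding Let_def
  proof (intro impI recovery_order_ts[OF DDt alpha lam s2 bdef enorm Tcard xhat_min t refl refl], goal_cases)
    case 1
    show ?case by (simp add: mult_ac)
  next
    case 2
    then show ?case .
  next
    case 3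
    show ?case by (rule \<tau>)
  next
    case 4
    show ?case by (simp add: mult_ac)
  qed
next
  show "let \<delta> = D_RIC A D s;
         \<theta> = D_ROC A D s s;
         \<rho> = \<delta> + (sqrt 2 + 1) * (sqrt s + \<alpha>) / (sqrt 2 * (sqrt s - 1)) * \<theta>;
         \<tau> = (sqrt 2 + 1) * \<theta> / (sqrt 2 * (1 - \<rho>)) * (1 / (sqrt s - 1));
         C = 1 + (sqrt 2 + 1) * \<theta> / (sqrt 2 * (1 - \<rho>)) * (sqrt s + \<alpha>) / (sqrt s - 1)
     in \<rho> < 1 \<longrightarrow>
        norm (xhat - x) \<le> recovery_bound s \<alpha> \<rho> \<delta> \<tau> C lam
          (\<Sum>i\<in>- T. \<bar>(transpose D *v x) $ i\<bar>)"
    unfolding Let_def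
    by (intro impI recovery_order_s[OF DDt alpha lam s2 bdef enorm Tcard xhat_min]) (auto simp: mult_ac)
qed

end
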